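(* Let $r\in[-R_{\max},R_{\max}]^K$ with $r(1)>r(2)>\cdots>r(K)$, let $a^\star=1$, and let $X\in\mathbb{R}^{K\times d}$ with $d\le K$ have rows $x_1,\dots,x_K\in\mathbb{R}^d$. Assume that: (a) there exists $w\in\mathbb{R}^d$ such that $r'=Xw$ satisfies, for all $i,j\in[K]$, $r'(i)>r'(j)$ if and only if $r(i)>r(j)$; (b) for all actions $i,j,k\in[K]$ (with $j=k$ allowed) such that $r(i)>r(j)$ and $r(i)>r(k)$, one has $\langle x_i-x_j,\,x_{a^\star}-x_k\rangle>0$ if $i=a^\star$ or $j=k$, and $\langle x_i-x_j,\,x_{a^\star}-x_k\rangle\ge 0$ otherwise. Let $0<\eta<\frac{4}{9\,R_{\max}\,\lambda_{\max}(X^\top X)}$, let $\theta_1\in\mathbb{R}^d$ be arbitrary, and for $t\ge1$ let $\theta_{t+1}=\theta_t+\eta\,X^\top(\mathrm{diag}(\pi_{\theta_t})-\pi_{\theta_t}\pi_{\theta_t}^\top)\,r$. Then the policies converge to the optimal policy: $\lim_{t\to\infty}\pi_{\theta_t}(a^\star)=1$.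
   Context: $[K]=\{1,\dots,K\}$ is the set of actions and $R_{\max}>0$. For $\theta\in\mathbb{R}^d$, $\pi_\theta=\mathrm{softmax}(X\theta)$, i.e. $\pi_\theta(a)=\exp(\langle x_a,\theta\rangle)/\sum_{a'\in[K]}\exp(\langle x_{a'},\theta\rangle)$. $\lambda_{\max}(M)$ denotes the largest eigenvalue of $M$. The ordering $r(1)>\cdots>r(K)$ is the paper's labeling convention under its assumption that mean rewards are pairwise distinct. *)

theory Defs
  imports "HOL-Analysis.Analysis"
begin

definition eigenvalues :: "real^'n^'n \<Rightarrow> real set" where
  "eigenvalues A = {l. \<exists>v. v \<noteq> 0 \<and> A *v v = l *\<^sub>R v}"

text \<open>The set of real eigenvalues is always finite, and it is nonempty for the symmetric
  matrices to which this is applied, so the maximum is attained there.  For a matrix without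
  real eigenvalues the value is unspecified.\<close>
definition lambda_max :: "real^'n^'n \<Rightarrow> real" where
  "lambda_max A = Max (eigenvalues A)"

definition diag :: "real^'n \<Rightarrow> real^'n^'n" where
  "diag v = (\<chi> i j. if i = j then v $ i else 0)"

definition outer :: "real^'m \<Rightarrow> real^'n \<Rightarrow> real^'n^'m" where
  "outer u v = (\<chi> i j. u $ i * v $ j)"

definition softmax :: "real^'k \<Rightarrow> real^'k" where
  "softmax z = (\<chi> a. exp (z $ a) / (\<Sum>b\<in>UNIV. exp (z $ b)))"

definition policy :: "real^'d^'k \<Rightarrow> real^'d \<Rightarrow> real^'k" where
  "policy X \<theta> = softmax (X *v \<theta>)"

definition pg_step :: "real^'d^'k \<Rightarrow> real^'k \<Rightarrow> real \<Rightarrow> real^'d \<Rightarrow> real^'d" where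
  "pg_step X r \<eta> \<theta> =
     \<theta> + \<eta> *\<^sub>R (transpose X *v
       ((diag (policy X \<theta>) - outer (policy X \<theta>) (policy X \<theta>)) *v r))"

end

theory Submission imports Defs begin

text \<open>The expected reward along a line in parameter space has second derivative
  \<open>E[(r - E r) (y - E y)\<^sup>2]\<close>, which is at most \<open>2 R \<lambda>\<^sub>m\<^sub>a\<^sub>x\<close> in absolute value per squared unit of parameter,
  so every step increases the expected reward and the gradients tend to 0. The inner product of the
  gradient with the direction \<open>w\<close> is a sum of nonnegative multiples of the products \<open>\<pi>(i) \<pi>(j)\<close>, hence
  the policy converges to a single action \<open>k\<close>, whose reward is never exceeded by the expected reward.

  Suppose \<open>k\<close> is not the best action. By induction from the worst action upwards, for every action
  \<open>a\<close> worse than \<open>k\<close> the log ratio of \<open>\<pi>(best)\<close> and \<open>\<pi>(a)\<close> eventually grows by at least a multiple of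
  \<open>\<pi>(best)\<close> per step. As the expected reward stays below \<open>r(k)\<close>, the actions better than \<open>k\<close> are
  controlled by the worse ones and hence by \<open>best\<close>: \<open>1 - \<pi>(k)\<close> is at most a multiple of \<open>\<pi>(best)\<close>. So
  the log ratio of \<open>\<pi>(best)\<close> and \<open>\<pi>(k)\<close>, which tends to minus infinity, changes by at most a multiple
  of \<open>\<pi>(best)\<close> per step. Therefore the log ratios for the worse actions tend to infinity, so \<open>best\<close>
  outweighs all actions worse than \<open>k\<close> and pushes the expected reward above \<open>r(k)\<close>, a contradiction.\<close>

section \<open>The largest eigenvalue of a Gram matrix\<close>

text \<open>A maximiser of the Rayleigh quotient is a critical point. With the residual
  \<open>e = f v - l v\<close>, moving \<open>v\<close> to \<open>v + s e\<close> changes the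
  nonnegative gap \<open>l |u|^2 - u . f u\<close> from 0 to \<open>-2 s |e|^2\<close> plus a term
  of order \<open>s^2\<close>, which is negative for small \<open>s > 0\<close> unless
  \<open>e = 0\<close>.\<close>

lemma quadratic_form_max_eigenvector:
  fixes f :: "'a::real_inner \<Rightarrow> 'a"
  assumes "linear f" and sym: "\<And>u v. f u \<bullet> v = u \<bullet> f v"
    and le: "\<And>u. u \<bullet> f u \<le> l * (u \<bullet> u)" and eq: "v \<bullet> f v = l * (v \<bullet> v)"
  shows "f v = l *\<^sub>R v"
proof -
  define e where "e = f v - l *\<^sub>R v"
  have key: "0 \<le> - 2 * s * (e \<bullet> e) + s^2 * (l * (e \<bullet> e) - e \<bullet> f e)" for s
  proof -
    have "f (v + s *\<^sub>R e) = f v + s *\<^sub>R f e"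
      by (simp add: assms(1) linear_add linear_scale)
    moreover have "v \<bullet> f e = f v \<bullet> e" using sym by simp
    moreover have "f v \<bullet> e = e \<bullet> e + l * (v \<bullet> e)"
      by (simp add: e_def inner_diff_left inner_diff_right algebra_simps inner_commute)
    ultimately show ?thesis
      using le[of "v + s *\<^sub>R e"] eq
      by (simp add: inner_add_left inner_add_right algebra_simps inner_commute power2_eq_square)
  qed
  have "e \<bullet> e \<le> 0"
  proof (rule ccontr)
    assume "\<not> ?thesis"
    hence pos: "e \<bullet> e > 0" by linarith
    define q where "q = l * (e \<bullet> e) - e \<bullet> f e"
    have q0: "q \<ge> 0" using le[of e] by (simp add: q_def)
    \<comment> \<open>With this \<open>s\<close> the quadratic term \<open>s^2 q\<close> is at most
      \<open>s |e|^2\<close>, half the size of the linear term; \<open>q + 1\<close> avoids a zero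
      denominator.\<close>
    define s where "s = (e \<bullet> e) / (q + 1)"
    have s: "s > 0" using pos q0 by (simp add: s_def)
    have "s * q \<le> e \<bullet> e" using pos q0 by (simp add: s_def field_simps)
    hence "s * (s * q) \<le> s * (e \<bullet> e)" using s by (intro mult_left_mono) auto
    moreover have "0 < s * (e \<bullet> e)" using s pos by simp
    ultimately show False using key[of s] by (simp add: q_def[symmetric] power2_eq_square algebra_simps)
  qed
  hence "e = 0" by (metis inner_eq_zero_iff inner_ge_zero order_antisym)
  thus ?thesis by (simp add: e_def)
qed

lemma inner_gram: "(transpose X ** X *v u) \<bullet> v = (X *v u) \<bullet> (X *v (v::real^'d))"
  for X :: "real^'d^'k"
  by (metis dot_lmul_matrix matrix_vector_mul_assoc transpose_matrix_vector inner_commute)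

text \<open>Eigenvectors of a symmetric matrix for distinct eigenvalues are orthogonal, and pairwise
  orthogonal sets are finite. Finiteness lets \<open>Max\<close> bound every eigenvalue.\<close>

lemma finite_eigenvalues_gram: "finite (eigenvalues (transpose X ** X))"
  for X :: "real^'d^'k"
proof -
  let ?E = "eigenvalues (transpose X ** X)"
  have "\<forall>l\<in>?E. \<exists>v. v \<noteq> 0 \<and> (transpose X ** X) *v v = l *\<^sub>R v"
    unfolding eigenvalues_def by blast
  then obtain e where e: "\<And>l. l \<in> ?E \<Longrightarrow> e l \<noteq> 0 \<and> (transpose X ** X) *v e l = l *\<^sub>R e l"
    by (rule bchoice[THEN exE]) blast
  have orth: "e l \<bullet> e m = 0" if "l \<in> ?E" "m \<in> ?E" "l \<noteq> m" for l m
  proof -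
    have "l * (e l \<bullet> e m) = m * (e l \<bullet> e m)"
      using inner_gram[of X "e l" "e m"] inner_gram[of X "e m" "e l"] e[OF that(1)] e[OF that(2)]
      by (simp add: inner_commute)
    thus ?thesis using that by simp
  qed
  have inj: "inj_on e ?E"
  proof (rule inj_onI, rule ccontr)
    fix l m assume "l \<in> ?E" "m \<in> ?E" "e l = e m" "l \<noteq> m"
    thus False using orth[of l m] e[of m] by simp
  qed
  have "pairwise orthogonal (e ` ?E)"
    unfolding pairwise_def orthogonal_def using orth by auto
  hence "finite (e ` ?E)" by (rule pairwise_orthogonal_imp_finite)
  thus ?thesis using inj by (simp add: finite_image_iff)
qed

text \<open>By compactness the squared norm of \<open>X *v u\<close> has a maximum \<open>l\<close>
  on the unit sphere; the maximiser is an eigenvector of the Gram matrix with eigenvalue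
  \<open>l\<close>.\<close>

lemma norm_matrix_le_lambda_max:
  "(norm (X *v v))\<^sup>2 \<le> lambda_max (transpose X ** X) * (norm v)\<^sup>2"
  for X :: "real^'d^'k"
proof -
  let ?M = "transpose X ** X"
  have "continuous_on (sphere 0 1) (\<lambda>u::real^'d. (norm (X *v u))\<^sup>2)"
    by (intro continuous_intros linear_continuous_on linear_linear[THEN iffD1] matrix_vector_mul_linear)
  moreover have "sphere (0::real^'d) 1 \<noteq> {}" by simp
  ultimately obtain u :: "real^'d" where u: "norm u = 1"
      and max: "\<And>w. norm w = 1 \<Longrightarrow> (norm (X *v w))\<^sup>2 \<le> (norm (X *v u))\<^sup>2"
    using continuous_attains_sup[OF compact_sphere, of 0 1 "\<lambda>u. (norm (X *v u))\<^sup>2"] by auto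
  define l where "l = (norm (X *v u))\<^sup>2"
  have bound: "(norm (X *v w))\<^sup>2 \<le> l * (norm w)\<^sup>2" for w
  proof (cases "w = 0")
    case False
    have "(norm (X *v w))\<^sup>2 = (norm w)\<^sup>2 * (norm (X *v (w /\<^sub>R norm w)))\<^sup>2"
      using False by (simp add: matrix_vector_mult_scaleR power_mult_distrib[symmetric])
    also have "\<dots> \<le> (norm w)\<^sup>2 * l"
      unfolding l_def using False by (intro mult_left_mono max) auto
    finally show ?thesis by (simp add: mult.commute)
  qed simp
  have "?M *v u = l *\<^sub>R u"
  proof (rule quadratic_form_max_eigenvector[where f = "(*v) ?M"])
    show "linear ((*v) ?M)" by simp
    show "(?M *v a) \<bullet> b = a \<bullet> (?M *v b)" for a b
      using inner_gram[of X a b] inner_gram[of X b a] by (simp add: inner_commute)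
    show "a \<bullet> (?M *v a) \<le> l * (a \<bullet> a)" for a
      using bound[of a] inner_gram[of X a a] by (simp add: power2_norm_eq_inner inner_commute)
    show "u \<bullet> (?M *v u) = l * (u \<bullet> u)"
      using inner_gram[of X u u] u by (simp add: l_def power2_norm_eq_inner inner_commute norm_eq_1)
  qed
  moreover have "u \<noteq> 0" using u by auto
  ultimately have "l \<in> eigenvalues ?M" unfolding eigenvalues_def by blast
  hence "l \<le> lambda_max ?M" unfolding lambda_max_def by (intro Max_ge finite_eigenvalues_gram)
  thus ?thesis using bound[of v] mult_right_mono[of l "lambda_max ?M" "(norm v)\<^sup>2"] by simp
qed

section \<open>Derivatives of softmax averages\<close>

lemma softmax_pos: "0 < softmax z $ a"
  by (simp add: softmax_def sum_pos)

lemma sum_softmax: "(\<Sum>a\<in>UNIV. softmax z $ a) = 1"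
proof -
  have "(\<Sum>b\<in>UNIV. exp (z $ b)) > 0" by (simp add: sum_pos)
  thus ?thesis by (simp add: softmax_def flip: sum_divide_distrib)
qed

lemma softmax_ratio: "softmax z $ a = exp (z $ a - z $ b) * softmax z $ b"
  by (simp add: softmax_def exp_diff)

definition covar :: "('k::finite \<Rightarrow> real) \<Rightarrow> ('k \<Rightarrow> real) \<Rightarrow> ('k \<Rightarrow> real) \<Rightarrow> real" where
  "covar p u v = (\<Sum>a\<in>UNIV. p a * u a * v a) - (\<Sum>a\<in>UNIV. p a * u a) * (\<Sum>a\<in>UNIV. p a * v a)"

text \<open>The symmetrised form of the covariance: the sign of each pair's contribution can be read
  off when \<open>u\<close> and \<open>v\<close> order that pair alike.\<close>

lemma covar_pairs:
  assumes "(\<Sum>a\<in>UNIV. p a) = 1"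
  shows "2 * covar p u v = (\<Sum>i\<in>UNIV. \<Sum>j\<in>UNIV. p i * p j * (u i - u j) * (v i - v j))"
proof -
  have "(\<Sum>i\<in>UNIV. \<Sum>j\<in>UNIV. p i * p j * (u i - u j) * (v i - v j))
     = (\<Sum>i\<in>UNIV. \<Sum>j\<in>UNIV. (p i * u i * v i) * p j) + (\<Sum>i\<in>UNIV. \<Sum>j\<in>UNIV. p i * (p j * u j * v j))
      - (\<Sum>i\<in>UNIV. \<Sum>j\<in>UNIV. (p i * u i) * (p j * v j)) - (\<Sum>i\<in>UNIV. \<Sum>j\<in>UNIV. (p i * v i) * (p j * u j))"
    unfolding sum.distrib[symmetric] sum_subtractf[symmetric]
    by (intro sum.cong refl) (simp add: algebra_simps)
  thus ?thesis
    unfolding sum_product[symmetric] assms covar_def by simp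
qed


lemma softmax_has_derivative:
  "((\<lambda>s. softmax (z + s *\<^sub>R y) $ a) has_real_derivative
    softmax (z + s *\<^sub>R y) $ a * (y $ a - (\<Sum>b\<in>UNIV. softmax (z + s *\<^sub>R y) $ b * y $ b))) (at s)"
proof -
  define S where "S s = (\<Sum>b\<in>UNIV. exp (z $ b + s * y $ b))" for s
  have S: "S s > 0" for s by (simp add: S_def sum_pos)
  have sm: "softmax (z + s *\<^sub>R y) $ b = exp (z $ b + s * y $ b) / S s" for s b
    by (simp add: softmax_def S_def)
  have "(S has_real_derivative (\<Sum>b\<in>UNIV. exp (z $ b + s * y $ b) * y $ b)) (at s)"
    unfolding S_def by (auto intro!: derivative_eq_intros sum.cong)
  hence "((\<lambda>s. exp (z $ a + s * y $ a) / S s) has_real_derivative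
     (exp (z $ a + s * y $ a) * y $ a * S s
       - exp (z $ a + s * y $ a) * (\<Sum>b\<in>UNIV. exp (z $ b + s * y $ b) * y $ b)) / (S s * S s)) (at s)"
    using S[of s] by (auto intro!: derivative_eq_intros)
  moreover have "(exp (z $ a + s * y $ a) * y $ a * S s
       - exp (z $ a + s * y $ a) * (\<Sum>b\<in>UNIV. exp (z $ b + s * y $ b) * y $ b)) / (S s * S s)
    = exp (z $ a + s * y $ a) / S s * (y $ a - (\<Sum>b\<in>UNIV. exp (z $ b + s * y $ b) / S s * y $ b))"
  proof -
    have "(\<Sum>b\<in>UNIV. exp (z $ b + s * y $ b) / S s * y $ b)
        = (\<Sum>b\<in>UNIV. exp (z $ b + s * y $ b) * y $ b) / S s"
      by (simp add: sum_divide_distrib)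
    thus ?thesis using S[of s] by (simp add: field_simps)
  qed
  ultimately show ?thesis unfolding sm by simp
qed

lemma softmax_mean_has_derivative:
  fixes z y :: "real^'k"
  defines "p \<equiv> \<lambda>s a. softmax (z + s *\<^sub>R y) $ a"
  shows "((\<lambda>s. \<Sum>a\<in>UNIV. p s a * h a) has_real_derivative covar (p s) h (($) y)) (at s)"
proof -
  have "((\<lambda>s. \<Sum>a\<in>UNIV. p s a * h a) has_real_derivative
      (\<Sum>a\<in>UNIV. p s a * (y $ a - (\<Sum>b\<in>UNIV. p s b * y $ b)) * h a)) (at s)"
    unfolding p_def by (intro DERIV_sum DERIV_cmult_right softmax_has_derivative)
  moreover have "(\<Sum>a\<in>UNIV. p s a * (y $ a - c) * h a) = 
      (\<Sum>a\<in>UNIV. p s a * h a * y $ a) - (\<Sum>a\<in>UNIV. p s a * h a) * c" for c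
    unfolding sum_distrib_right sum_subtractf[symmetric] by (simp add: algebra_simps)
  ultimately show ?thesis by (simp add: covar_def)
qed

text \<open>The covariance is a polynomial in softmax means, so the previous lemma and the product
  rule apply; the result regroups into a mixed third central moment.\<close>

lemma softmax_covar_has_derivative:
  fixes z y :: "real^'k"
  defines "p \<equiv> \<lambda>s a. softmax (z + s *\<^sub>R y) $ a"
  defines "m \<equiv> \<lambda>s h. \<Sum>a\<in>UNIV. p s a * h a"
  shows "((\<lambda>s. covar (p s) h (($) y)) has_real_derivative
    (\<Sum>a\<in>UNIV. p s a * ((h a - m s h) * (y $ a - m s (($) y))\<^sup>2))) (at s)"
proof -
  let ?y = "($) y"
  have D: "((\<lambda>s. \<Sum>a\<in>UNIV. p s a * h a) has_real_derivative covar (p s) h ?y) (at s)" for h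
    unfolding p_def by (rule softmax_mean_has_derivative)
  have c: "covar (p s) h ?y = m s (\<lambda>a. h a * y $ a) - m s h * m s ?y" for s h
    by (simp add: covar_def m_def mult.assoc)
  have "((\<lambda>s. m s (\<lambda>a. h a * y $ a) - m s h * m s ?y) has_real_derivative
      covar (p s) (\<lambda>a. h a * y $ a) ?y - (covar (p s) h ?y * m s ?y + covar (p s) ?y ?y * m s h)) (at s)"
    unfolding m_def by (intro DERIV_diff DERIV_mult D)
  moreover have "covar (p s) (\<lambda>a. h a * y $ a) ?y - (covar (p s) h ?y * m s ?y + covar (p s) ?y ?y * m s h)
      = (\<Sum>a\<in>UNIV. p s a * ((h a - m s h) * (y $ a - m s ?y)\<^sup>2))"
  proof -
    have p1: "sum (p s) UNIV = 1" by (simp add: p_def sum_softmax)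
    have "(\<Sum>a\<in>UNIV. p s a * ((h a - c) * (y $ a - d)\<^sup>2)) =
       m s (\<lambda>a. h a * y $ a * y $ a) - 2 * d * m s (\<lambda>a. h a * y $ a) + d\<^sup>2 * m s h
        - c * (m s (\<lambda>a. y $ a * y $ a) - 2 * d * m s ?y + d\<^sup>2 * sum (p s) UNIV)" for c d
      unfolding m_def sum_distrib_left sum.distrib[symmetric] sum_subtractf[symmetric]
      by (intro sum.cong refl) (simp add: power2_eq_square algebra_simps)
    note expand = this
    show ?thesis unfolding expand c p1 by (simp add: power2_eq_square algebra_simps)
  qed
  ultimately show ?thesis unfolding c by simp
qed

text \<open>Taylor expansion along the segment from \<open>z\<close> to \<open>z + y\<close> with
  Lagrange remainder. In the second derivative the reward deviation is at most \<open>2 * R\<close>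
  and the variance of \<open>y\<close> at most its squared norm; the factor 1/2 leaves
  \<open>R\<close>.\<close>

lemma softmax_mean_second_order:
  fixes z y r :: "real^'k"
  assumes r: "\<And>a. \<bar>r $ a\<bar> \<le> R"
  shows "(\<Sum>a\<in>UNIV. softmax (z + y) $ a * r $ a) \<ge>
    (\<Sum>a\<in>UNIV. softmax z $ a * r $ a) + covar (($) (softmax z)) (($) r) (($) y) - R * (norm y)\<^sup>2"
proof -
  define p where "p s a = softmax (z + s *\<^sub>R y) $ a" for s :: real and a
  define m where "m s h = (\<Sum>a\<in>UNIV. p s a * h a)" for s h
  let ?r = "($) r" and ?y = "($) y"
  \<comment> \<open>\<open>Maclaurin\<close> takes the derivatives as a sequence; indices above 2
    merely repeat the second derivative.\<close>
  define D where "D n s = (if n = 0 then m s ?r else if n = 1 then covar (p s) ?r ?y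
    else (\<Sum>a\<in>UNIV. p s a * ((r $ a - m s ?r) * (y $ a - m s ?y)\<^sup>2)))" for n :: nat and s
  have D1: "(D 0 has_real_derivative D 1 t) (at t)" for t
    using softmax_mean_has_derivative[of z y ?r t] by (simp add: D_def[abs_def] m_def p_def[abs_def])
  have D2: "(D 1 has_real_derivative D 2 t) (at t)" for t
    using softmax_covar_has_derivative[of z y ?r t] by (simp add: D_def[abs_def] m_def p_def[abs_def])
  have "\<exists>t>0. t < 1 \<and> m 1 ?r = (\<Sum>n<2. D n 0 / fact n * 1 ^ n) + D 2 t / fact 2 * 1 ^ 2"
  proof (rule Maclaurin)
    show "\<forall>n t. n < 2 \<and> 0 \<le> t \<and> t \<le> 1 \<longrightarrow> (D n has_real_derivative D (Suc n) t) (at t)"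
      using D1 D2 by (auto simp: less_Suc_eq numeral_2_eq_2)
    show "D 0 = (\<lambda>s. m s ?r)" by (simp add: D_def fun_eq_iff)
  qed simp_all
  then obtain t where t: "m 1 ?r = m 0 ?r + covar (p 0) ?r ?y + D 2 t / 2"
    by (force simp: D_def lessThan_nat_numeral lessThan_Suc)
  have p1: "sum (p t) UNIV = 1" by (simp add: p_def sum_softmax)
  have p0: "p t a \<ge> 0" for a by (simp add: p_def less_imp_le softmax_pos)
  have p: "p t a \<ge> 0" "p t a \<le> 1" for a
    using member_le_sum[of a UNIV "p t"] p0 by (simp_all add: p1)
  have mr: "\<bar>m t ?r\<bar> \<le> R"
  proof -
    have "\<bar>m t ?r\<bar> \<le> (\<Sum>a\<in>UNIV. \<bar>p t a * r $ a\<bar>)" unfolding m_def by (rule sum_abs)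
    also have "\<dots> \<le> (\<Sum>a\<in>UNIV. p t a * R)"
      using p r by (intro sum_mono) (simp add: abs_mult mult_left_mono)
    also have "\<dots> = R" by (simp add: p1 flip: sum_distrib_right)
    finally show ?thesis .
  qed
  have R: "R \<ge> 0" using mr by linarith
  have "- D 2 t \<le> (\<Sum>a\<in>UNIV. p t a * (2 * R * (y $ a - m t ?y)\<^sup>2))"
  proof -
    have "- (p t a * ((r $ a - m t ?r) * (y $ a - m t ?y)\<^sup>2)) \<le> p t a * (2 * R * (y $ a - m t ?y)\<^sup>2)" for a
    proof -
      have "(m t ?r - r $ a) * (y $ a - m t ?y)\<^sup>2 \<le> 2 * R * (y $ a - m t ?y)\<^sup>2"
        using r[of a] mr by (intro mult_right_mono) auto
      from mult_left_mono[OF this p(1)[of a]] show ?thesis by (simp add: algebra_simps)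
    qed
    hence "(\<Sum>a\<in>UNIV. - (p t a * ((r $ a - m t ?r) * (y $ a - m t ?y)\<^sup>2)))
        \<le> (\<Sum>a\<in>UNIV. p t a * (2 * R * (y $ a - m t ?y)\<^sup>2))" by (intro sum_mono)
    thus ?thesis by (simp add: D_def sum_negf)
  qed
  also have "\<dots> = 2 * R * (m t (\<lambda>a. (y $ a)\<^sup>2) - (m t ?y)\<^sup>2)"
  proof -
    have "(\<Sum>a\<in>UNIV. p t a * (2 * R * (y $ a - d)\<^sup>2))
        = 2 * R * (m t (\<lambda>a. (y $ a)\<^sup>2) - 2 * d * m t ?y + d\<^sup>2 * sum (p t) UNIV)" for d
      unfolding m_def sum_distrib_left sum.distrib[symmetric] sum_subtractf[symmetric]
      by (intro sum.cong refl) (simp add: power2_eq_square algebra_simps)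
    thus ?thesis unfolding p1 by (simp add: power2_eq_square)
  qed
  also have "\<dots> \<le> 2 * R * m t (\<lambda>a. (y $ a)\<^sup>2)"
    using R by (intro mult_left_mono) auto
  also have "m t (\<lambda>a. (y $ a)\<^sup>2) \<le> (norm y)\<^sup>2"
    unfolding m_def power2_norm_eq_inner inner_vec_def
    using p by (intro sum_mono) (simp add: power2_eq_square mult_left_le_one_le)
  finally have "- D 2 t \<le> 2 * R * (norm y)\<^sup>2" using R by (simp add: mult_left_mono)
  moreover have "p 1 = ($) (softmax (z + y))" "p 0 = ($) (softmax z)" by (simp_all add: p_def fun_eq_iff)
  ultimately show ?thesis using t unfolding m_def by simp
qed

section \<open>Policy gradient dynamics\<close>

lemma eventually_mono_bounded_below:
  fixes u :: "nat \<Rightarrow> real"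
  assumes "\<forall>\<^sub>F t in sequentially. u t \<le> u (Suc t)"
  shows "\<exists>B. \<forall>\<^sub>F t in sequentially. B \<le> u t"
proof -
  obtain n where n: "\<And>t. t \<ge> n \<Longrightarrow> u t \<le> u (Suc t)"
    using assms unfolding eventually_sequentially by blast
  have "u n \<le> u t" if "t \<ge> n" for t
    using that by (induction t rule: dec_induct) (auto intro: order_trans n)
  thus ?thesis unfolding eventually_sequentially by blast
qed

lemma pg_gradient_inner:
  "(transpose X *v ((diag p - outer p p) *v r)) \<bullet> v = covar (($) p) (($) r) (\<lambda>a. X $ a \<bullet> v)"
  for X :: "real^'d^'k"
proof -
  define S where "S = (\<Sum>b\<in>UNIV. p $ b * r $ b)"
  have g: "((diag p - outer p p) *v r) $ a = p $ a * r $ a - p $ a * S" for a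
  proof -
    have "(diag p *v r) $ a = (\<Sum>j\<in>UNIV. if a = j then p $ a * r $ j else 0)"
      unfolding diag_def matrix_vector_mult_def vec_lambda_beta by (intro sum.cong refl) auto
    moreover have "(outer p p *v r) $ a = p $ a * S"
      by (simp add: outer_def matrix_vector_mult_def sum_distrib_left mult.assoc S_def)
    ultimately show ?thesis by (simp add: matrix_vector_mult_diff_rdistrib)
  qed
  have "(transpose X *v u) \<bullet> v = (\<Sum>a\<in>UNIV. u $ a * (X $ a \<bullet> v))" for u
    by (simp add: transpose_matrix_vector dot_lmul_matrix inner_vec_def[of u] matrix_vector_mul_component)
  thus ?thesis
    by (simp add: g covar_def S_def[symmetric] left_diff_distrib sum_subtractf sum_distrib_left mult.assoc mult.left_commute)
qed

text \<open>Smaller actions are better. The step size condition is what makes the second-order loss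
  of a step smaller than its first-order gain.\<close>

locale softmax_policy_gradient =
  fixes X :: "real^'d^('k::{finite,linorder})" and r :: "real^('k::{finite,linorder})"
    and R \<eta> :: real and best :: "'k::{finite,linorder}" and \<Theta> :: "nat \<Rightarrow> real^'d"
  assumes r_bound: "\<bar>r $ a\<bar> \<le> R"
    and r_decreasing: "i < j \<Longrightarrow> r $ j < r $ i"
    and best_le: "best \<le> a"
    and ordering: "\<exists>w. \<forall>i j. i < j \<longrightarrow> X $ j \<bullet> w < X $ i \<bullet> w"
    and feature_best: "best < j \<Longrightarrow> best < k \<Longrightarrow> 0 < (X $ best - X $ j) \<bullet> (X $ best - X $ k)"
    and feature: "i < j \<Longrightarrow> i < k \<Longrightarrow> 0 \<le> (X $ i - X $ j) \<bullet> (X $ best - X $ k)"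
    and eta_pos: "0 < \<eta>"
    and eta_small: "\<eta> * R * lambda_max (transpose X ** X) < 1"
    and step: "\<Theta> (Suc t) = pg_step X r \<eta> (\<Theta> t)"
begin

definition P :: "nat \<Rightarrow> 'k \<Rightarrow> real" where "P t a = policy X (\<Theta> t) $ a"

definition value_at :: "nat \<Rightarrow> real" where "value_at t = (\<Sum>a\<in>UNIV. P t a * r $ a)"

definition G :: "nat \<Rightarrow> real^'d" where
  "G t = transpose X *v ((diag (policy X (\<Theta> t)) - outer (policy X (\<Theta> t)) (policy X (\<Theta> t))) *v r)"

lemma P_pos: "0 < P t a"
  by (simp add: P_def policy_def softmax_pos)

lemma sum_P: "(\<Sum>a\<in>UNIV. P t a) = 1"
  by (simp add: P_def policy_def sum_softmax)

lemma P_le_compl: assumes "i \<noteq> k" shows "P t i \<le> 1 - P t k"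
proof -
  have "(\<Sum>a\<in>{i, k}. P t a) \<le> (\<Sum>a\<in>UNIV. P t a)"
    by (rule sum_mono2) (auto simp: P_pos less_imp_le)
  thus ?thesis using assms by (simp add: sum_P)
qed

lemma P_le_1: "P t a \<le> 1"
  using member_le_sum[of a UNIV "P t"] by (simp add: sum_P P_pos less_imp_le)

lemma P_ratio: "P t a = exp ((X $ a - X $ b) \<bullet> \<Theta> t) * P t b"
  unfolding P_def policy_def
  by (subst softmax_ratio[of _ a b]) (simp add: matrix_vector_mul_component inner_diff_left)

lemma r_less_iff: "r $ j < r $ i \<longleftrightarrow> i < j"
  using r_decreasing[of i j] r_decreasing[of j i] by (cases i j rule: linorder_cases) auto

lemma R_nonneg: "0 \<le> R"
  using r_bound[of best] by linarith

section \<open>Monotone improvement of the expected reward and vanishing gradients\<close>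

lemma Theta_Suc: "\<Theta> (Suc t) = \<Theta> t + \<eta> *\<^sub>R G t"
  by (simp add: step pg_step_def G_def)

lemma G_inner: "G t \<bullet> v = covar (P t) (($) r) (\<lambda>a. X $ a \<bullet> v)"
  unfolding G_def pg_gradient_inner by (simp add: P_def[abs_def])

lemma G_inner_pairs:
  "2 * (G t \<bullet> v) = (\<Sum>i\<in>UNIV. \<Sum>j\<in>UNIV. P t i * P t j * ((r $ i - r $ j) * ((X $ i - X $ j) \<bullet> v)))"
  unfolding G_inner covar_pairs[OF sum_P] by (simp add: inner_diff_left mult.assoc)

text \<open>The second-order bound is applied to the displacement of the logits
  \<open>X *v \<Theta> t\<close>: its linear term is \<open>\<eta> |G|^2\<close>, its quadratic loss
  at most \<open>\<eta>^2 R \<lambda> |G|^2\<close>, where \<open>\<lambda>\<close> is the largest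
  eigenvalue.\<close>

lemma value_ascent:
  "\<eta> * (1 - \<eta> * R * lambda_max (transpose X ** X)) * (norm (G t))\<^sup>2 \<le> value_at (Suc t) - value_at t"
proof -
  let ?y = "X *v (\<eta> *\<^sub>R G t)" and ?l = "lambda_max (transpose X ** X)"
  have "X *v \<Theta> (Suc t) = X *v \<Theta> t + ?y"
    by (simp add: Theta_Suc matrix_vector_right_distrib)
  moreover have "covar (P t) (($) r) (($) ?y) = \<eta> * (norm (G t))\<^sup>2"
  proof -
    have "($) ?y = (\<lambda>a. X $ a \<bullet> (\<eta> *\<^sub>R G t))"
      by (simp add: fun_eq_iff matrix_vector_mul_component)
    thus ?thesis using G_inner[of t "\<eta> *\<^sub>R G t"] by (simp add: power2_norm_eq_inner)
  qed
  moreover have "R * (norm ?y)\<^sup>2 \<le> R * (?l * (norm (\<eta> *\<^sub>R G t))\<^sup>2)"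
    by (intro mult_left_mono norm_matrix_le_lambda_max R_nonneg)
  ultimately show ?thesis
    using softmax_mean_second_order[of r R "X *v \<Theta> t" ?y, OF r_bound]
    by (simp add: value_at_def P_def[abs_def] policy_def power_mult_distrib power2_eq_square[of \<eta>] algebra_simps)
qed

lemma ascent_factor_pos: "0 < \<eta> * (1 - \<eta> * R * lambda_max (transpose X ** X))"
  using eta_pos eta_small by simp

lemma incseq_value: "incseq value_at"
proof (rule incseq_SucI)
  fix t show "value_at t \<le> value_at (Suc t)"
    using order_trans[OF mult_nonneg_nonneg[OF less_imp_le[OF ascent_factor_pos] zero_le_power2] value_ascent[of t]]
    by simp
qed

lemma value_le: "value_at t \<le> R"
proof -
  have "value_at t \<le> (\<Sum>a\<in>UNIV. P t a * R)" unfolding value_at_def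
    using r_bound by (intro sum_mono mult_left_mono) (auto simp: abs_le_iff P_pos less_imp_le)
  thus ?thesis by (simp add: sum_P flip: sum_distrib_right)
qed

lemma value_limit: "\<exists>L. value_at \<longlonglongrightarrow> L \<and> (\<forall>t. value_at t \<le> L)"
  by (rule incseq_convergent[OF incseq_value, of R]) (auto simp: value_le)

lemma G_tendsto_0: "G \<longlonglongrightarrow> 0"
proof -
  let ?c = "\<eta> * (1 - \<eta> * R * lambda_max (transpose X ** X))"
  obtain L where L: "value_at \<longlonglongrightarrow> L" using value_limit by blast
  have "(\<lambda>t. (value_at (Suc t) - value_at t) / ?c) \<longlonglongrightarrow> (L - L) / ?c"
    by (intro tendsto_divide tendsto_diff L LIMSEQ_Suc[OF L] tendsto_const) (rule less_imp_neq[OF ascent_factor_pos, symmetric])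
  hence lim: "(\<lambda>t. (value_at (Suc t) - value_at t) / ?c) \<longlonglongrightarrow> 0" by simp
  have le: "(norm (G t))\<^sup>2 \<le> (value_at (Suc t) - value_at t) / ?c" for t
    unfolding pos_le_divide_eq[OF ascent_factor_pos] using value_ascent[of t] by (simp add: mult.commute)
  have "(\<lambda>t. (norm (G t))\<^sup>2) \<longlonglongrightarrow> 0"
    by (rule tendsto_sandwich[OF _ _ tendsto_const lim]) (use le in simp_all)
  from tendsto_real_sqrt[OF this] show ?thesis by (simp add: tendsto_norm_zero_iff)
qed

section \<open>Concentration of the policy on a single action\<close>

text \<open>Along \<open>w\<close> the features are ordered like the rewards, so every term of the
  pair sum for \<open>G t \<bullet> w\<close> is nonnegative and hence bounded by the sum, which
  tends to 0.\<close>

lemma P_prod_tendsto_0: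
  assumes "i \<noteq> j" shows "(\<lambda>t. P t i * P t j) \<longlonglongrightarrow> 0"
proof -
  obtain w where w: "\<And>i j. i < j \<Longrightarrow> X $ j \<bullet> w < X $ i \<bullet> w" using ordering by blast
  define q where "q i j = (r $ i - r $ j) * ((X $ i - X $ j) \<bullet> w)" for i j
  have q: "0 < q i j" if "i \<noteq> j" for i j
    using that w[of i j] w[of j i] r_decreasing[of i j] r_decreasing[of j i]
    by (cases i j rule: linorder_cases) (auto simp: q_def inner_diff_left mult_neg_neg)
  hence q0: "0 \<le> q i j" for i j by (cases "i = j") (auto simp: q_def less_imp_le)
  have pair_le: "P t i * P t j * q i j \<le> 2 * (G t \<bullet> w)" for t
  proof -
    have "P t i * P t j * q i j \<le> (\<Sum>j\<in>UNIV. P t i * P t j * q i j)"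
      by (rule member_le_sum) (auto intro!: mult_nonneg_nonneg q0 simp: P_pos less_imp_le)
    also have "\<dots> \<le> (\<Sum>i\<in>UNIV. \<Sum>j\<in>UNIV. P t i * P t j * q i j)"
      by (rule member_le_sum) (auto intro!: sum_nonneg mult_nonneg_nonneg q0 simp: P_pos less_imp_le)
    finally show ?thesis by (simp add: G_inner_pairs q_def)
  qed
  have "(\<lambda>t. 2 * (G t \<bullet> w) / q i j) \<longlonglongrightarrow> 2 * (0 \<bullet> w) / q i j"
    using q[OF assms] by (intro tendsto_intros G_tendsto_0) auto
  hence lim: "(\<lambda>t. 2 * (G t \<bullet> w) / q i j) \<longlonglongrightarrow> 0" by simp
  have "P t i * P t j \<le> 2 * (G t \<bullet> w) / q i j" for t
    using pair_le[of t] by (simp add: pos_le_divide_eq[OF q[OF assms]])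
  moreover have "0 \<le> P t i * P t j" for t by (simp add: P_pos less_imp_le)
  ultimately show ?thesis
    by (intro tendsto_sandwich[OF _ _ tendsto_const lim]) simp_all
qed

text \<open>Actions whose reward differs from the limit \<open>L\<close> of the expected reward lose
  all their probability; as rewards are distinct, exactly one action remains. The expected reward
  increases to \<open>L\<close>, hence never exceeds it.\<close>

lemma P_concentrates: obtains k where "(\<lambda>t. P t k) \<longlonglongrightarrow> 1" "\<And>t. value_at t \<le> r $ k"
proof -
  obtain L where L: "value_at \<longlonglongrightarrow> L" and le: "\<And>t. value_at t \<le> L" using value_limit by blast
  \<comment> \<open>\<open>P t i * (value_at t - r $ i)\<close> is a combination of the products \<open>P t i * P t j\<close> with \<open>j \<noteq> i\<close>.\<close>
  have vanish: "(\<lambda>t. P t i) \<longlonglongrightarrow> 0" if "r $ i \<noteq> L" for i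
  proof -
    have "(\<lambda>t. \<Sum>j\<in>UNIV. P t i * P t j * (r $ j - r $ i)) \<longlonglongrightarrow> (\<Sum>j\<in>(UNIV::'k set). 0)"
    proof (rule tendsto_sum)
      fix j show "(\<lambda>t. P t i * P t j * (r $ j - r $ i)) \<longlonglongrightarrow> 0"
        by (cases "i = j") (auto intro!: tendsto_mult_left_zero P_prod_tendsto_0)
    qed
    moreover have "(\<Sum>j\<in>UNIV. P t i * P t j * (r $ j - r $ i)) = P t i * (value_at t - r $ i)" for t
    proof -
      have "(\<Sum>j\<in>UNIV. P t i * P t j * (r $ j - r $ i))
          = P t i * (value_at t - r $ i * (\<Sum>j\<in>UNIV. P t j))"
        unfolding value_at_def sum_distrib_left sum_subtractf[symmetric]
        by (intro sum.cong refl) (simp add: algebra_simps)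
      thus ?thesis by (simp add: sum_P)
    qed
    ultimately have "(\<lambda>t. P t i * (value_at t - r $ i)) \<longlonglongrightarrow> 0" by simp
    \<comment> \<open>Replacing \<open>value_at t\<close> by its limit costs a null sequence and
      leaves \<open>P t i * (L - r $ i)\<close>.\<close>
    hence a: "(\<lambda>t. P t i * (value_at t - r $ i) - P t i * (value_at t - L)) \<longlonglongrightarrow> 0 - 0"
    proof (rule tendsto_diff)
      have "(\<lambda>t. value_at t - L) \<longlonglongrightarrow> 0" using L by (simp add: LIM_zero)
      thus "(\<lambda>t. P t i * (value_at t - L)) \<longlonglongrightarrow> 0"
        by (rule Lim_null_comparison[rotated, OF tendsto_norm_zero])
           (simp add: abs_mult P_le_1 P_pos less_imp_le mult_left_le_one_le)
    qed
    have "(\<lambda>t. P t i * (L - r $ i) / (L - r $ i)) \<longlonglongrightarrow> 0 / (L - r $ i)"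
      using that a by (intro tendsto_divide tendsto_const) (auto simp: algebra_simps)
    thus ?thesis using that by simp
  qed
  have "\<exists>k. r $ k = L"
  proof (rule ccontr)
    assume "\<nexists>k. r $ k = L"
    hence "(\<lambda>t. \<Sum>i\<in>UNIV. P t i) \<longlonglongrightarrow> (\<Sum>i\<in>(UNIV::'k set). 0)"
      by (intro tendsto_sum vanish) auto
    thus False by (simp add: sum_P LIMSEQ_const_iff)
  qed
  then obtain k where k: "r $ k = L" by blast
  have "(\<lambda>t. 1 - (\<Sum>i\<in>UNIV - {k}. P t i)) \<longlonglongrightarrow> 1 - (\<Sum>i\<in>UNIV - {k}. 0)"
  proof (intro tendsto_diff tendsto_const tendsto_sum vanish)
    fix i assume "i \<in> UNIV - {k}"
    thus "r $ i \<noteq> L" using k r_less_iff[of i k] r_less_iff[of k i] by auto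
  qed
  moreover have "1 - (\<Sum>i\<in>UNIV - {k}. P t i) = P t k" for t
    using sum_P[of t] sum.remove[of UNIV k "P t"] by simp
  ultimately have "(\<lambda>t. P t k) \<longlonglongrightarrow> 1" by simp
  thus ?thesis using that[of k] le k by simp
qed

subsection \<open>Log ratios to the best action\<close>

text \<open>This is the logarithm of \<open>P t best / P t a\<close>, in a form linear in the
  parameter.\<close>

definition log_ratio :: "'k \<Rightarrow> nat \<Rightarrow> real" where
  "log_ratio a t = (X $ best - X $ a) \<bullet> \<Theta> t"

text \<open>Up to the factor \<open>\<eta> / 2\<close>, the coefficient of
  \<open>P t i * P t j\<close> in the one-step increment of \<open>log_ratio a\<close>.\<close>

definition pair_weight :: "'k \<Rightarrow> 'k \<Rightarrow> 'k \<Rightarrow> real" where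
  "pair_weight i j a = (r $ i - r $ j) * ((X $ i - X $ j) \<bullet> (X $ best - X $ a))"

lemma pair_weight_sym: "pair_weight i j a = pair_weight j i a"
  by (simp add: pair_weight_def inner_diff_left algebra_simps)

lemma pair_weight_self [simp]: "pair_weight i i a = 0"
  by (simp add: pair_weight_def)

text \<open>By symmetry \<open>i\<close> may be taken as the better of the two actions; it then
  beats both \<open>j\<close> and \<open>a\<close>, which is the situation of
  \<open>feature\<close>.\<close>

lemma pair_weight_nonneg: assumes "i < a \<or> j < a" shows "0 \<le> pair_weight i j a"
proof -
  have *: "0 \<le> pair_weight i j a" if "i < j" "i < a" for i j
    using feature[OF that] r_decreasing[OF that(1)] by (simp add: pair_weight_def)
  show ?thesis
    using *[of i j] *[of j i] assms pair_weight_sym[of i j a]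
    by (cases i j rule: linorder_cases) auto
qed

lemma pair_weight_best: "best < j \<Longrightarrow> best < a \<Longrightarrow> 0 < pair_weight best j a"
  using feature_best[of j a] r_decreasing[of best j] by (simp add: pair_weight_def)

lemma pair_weight_bound: "\<exists>C>0. \<forall>i j a. \<bar>pair_weight i j a\<bar> \<le> C"
proof -
  have "finite (range (\<lambda>(i, j, a). \<bar>pair_weight i j a\<bar>))" by simp
  then obtain C where C: "\<And>x. x \<in> range (\<lambda>(i, j, a). \<bar>pair_weight i j a\<bar>) \<Longrightarrow> x \<le> C"
    by (meson Max_ge)
  have "\<bar>pair_weight i j a\<bar> \<le> C" for i j a
    by (rule C) (auto intro!: image_eqI[where x = "(i, j, a)"])
  hence "\<forall>i j a. \<bar>pair_weight i j a\<bar> \<le> max C 1" by (meson max.coboundedI1)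
  thus ?thesis by (intro exI[of _ "max C 1"]) auto
qed

lemma log_ratio_step:
  "2 * (log_ratio a (Suc t) - log_ratio a t)
    = \<eta> * (\<Sum>i\<in>UNIV. \<Sum>j\<in>UNIV. P t i * P t j * pair_weight i j a)"
proof -
  have "log_ratio a (Suc t) - log_ratio a t = \<eta> * (G t \<bullet> (X $ best - X $ a))"
    by (simp add: log_ratio_def Theta_Suc inner_add_right inner_commute)
  thus ?thesis using G_inner_pairs[of t "X $ best - X $ a"] by (simp add: pair_weight_def)
qed

lemma P_best_log_ratio: "P t best = exp (log_ratio a t) * P t a"
  unfolding log_ratio_def by (rule P_ratio)

lemma P_log_ratio: "P t a = exp (- log_ratio a t) * P t best"
  unfolding P_best_log_ratio[of t a] by (simp add: exp_minus)

section \<open>Excluding a suboptimal limit action \<open>k\<close>\<close>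

context
  fixes k :: 'k
  assumes k_lim: "(\<lambda>t. P t k) \<longlonglongrightarrow> 1" and best_k: "best < k"
begin

lemma eventually_compl_less: assumes "0 < e" shows "\<forall>\<^sub>F t in sequentially. 1 - P t k < e"
proof -
  have "\<forall>\<^sub>F t in sequentially. 1 - e < P t k"
    by (rule order_tendstoD(1)[OF k_lim]) (use assms in simp)
  thus ?thesis by eventually_elim simp
qed

text \<open>Only pairs of two actions that are both at least as bad as \<open>a\<close> can contribute negatively, and
  such a pair contains an action worse than \<open>a\<close>, whose probability is controlled by that of the best
  action; the other factor is at most \<open>1 - P t k\<close> and tends to 0. The pair \<open>best, k\<close> then dominates.\<close>
lemma log_ratio_growth_step:
  assumes a: "k < a" and "0 < C" and below: "\<forall>\<^sub>F t in sequentially. \<forall>b\<in>{a<..}. P t b \<le> C * P t best"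
  shows "\<exists>c>0. \<forall>\<^sub>F t in sequentially. c * P t best \<le> log_ratio a (Suc t) - log_ratio a t"
proof -
  let ?N = "real CARD('k)"
  obtain M where M: "M > 0" "\<And>i j a. \<bar>pair_weight i j a\<bar> \<le> M" using pair_weight_bound by blast
  define w where "w = pair_weight best k a"
  have w: "w > 0" unfolding w_def using best_k a by (intro pair_weight_best) auto
  have N: "?N > 0" by simp
  \<comment> \<open>The bound 1/2 keeps \<open>P t k\<close> at least 1/2, so the pair
    \<open>best, k\<close> gains at least \<open>w / 2\<close> times \<open>P t best\<close>; the
    other bound keeps the total loss of all pairs below half of that.\<close>
  define e where "e = min (1/2) (w / (4 * ?N * ?N * M * C))"
  have e: "e > 0" using w N M \<open>0 < C\<close> by (simp add: e_def)
  have "\<forall>\<^sub>F t in sequentially. \<eta> * w / 8 * P t best \<le> log_ratio a (Suc t) - log_ratio a t"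
    using below eventually_compl_less[OF e]
  proof eventually_elim
    case (elim t)
    let ?p = "P t best" and ?d = "1 - P t k"
    have p: "0 \<le> ?p" by (simp add: P_pos less_imp_le)
    have d: "0 \<le> ?d" using P_le_1[of t k] by simp
    have slack: "0 \<le> M * (C * ?p * ?d)" using M(1) \<open>0 < C\<close> p d by simp
    have bad: "- (M * (C * ?p * ?d)) \<le> P t i * P t j * pair_weight i j a" if "a \<le> i" "i < j" for i j
    proof -
      have "P t j \<le> C * ?p" using elim(1) that by auto
      moreover have "P t i \<le> ?d" using that a by (intro P_le_compl) auto
      ultimately have "P t i * P t j \<le> ?d * (C * ?p)"
        using P_pos d by (intro mult_mono) (auto simp: less_imp_le)
      hence "P t i * P t j * M \<le> ?d * (C * ?p) * M" using M(1) by (intro mult_right_mono) auto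
      moreover have "P t i * P t j * (- M) \<le> P t i * P t j * pair_weight i j a"
        using M(2)[of i j a] by (intro mult_left_mono) (auto simp: abs_le_iff P_pos less_imp_le)
      ultimately show ?thesis by (simp add: algebra_simps)
    qed
    \<comment> \<open>Every pair is charged the worst possible loss and only the ordered pair
      \<open>best, k\<close> is credited, so that the double sum has a closed form.\<close>
    have "(if i = best then if j = k then ?p * P t k * w else 0 else 0) - M * (C * ?p * ?d)
        \<le> P t i * P t j * pair_weight i j a" for i j
    proof (cases "i < a \<or> j < a")
      case True
      have "0 \<le> P t i * P t j * pair_weight i j a"
        using pair_weight_nonneg[OF True] by (simp add: P_pos less_imp_le)
      thus ?thesis using slack by (auto simp: w_def)
    next
      case False
      hence "i \<noteq> best" using a best_k by auto
      moreover have "- (M * (C * ?p * ?d)) \<le> P t i * P t j * pair_weight i j a"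
        using False bad[of i j] bad[of j i] slack pair_weight_sym[of i j a]
        by (cases i j rule: linorder_cases) (auto simp: mult.commute[of "P t i"])
      ultimately show ?thesis by simp
    qed
    hence "(\<Sum>i\<in>UNIV. \<Sum>j\<in>UNIV. (if i = best then if j = k then ?p * P t k * w else 0 else 0) - M * (C * ?p * ?d))
      \<le> (\<Sum>i\<in>UNIV. \<Sum>j\<in>UNIV. P t i * P t j * pair_weight i j a)"
      by (intro sum_mono)
    moreover have "(\<Sum>i\<in>UNIV. \<Sum>j\<in>UNIV. (if i = best then if j = k then ?p * P t k * w else 0 else 0) - M * (C * ?p * ?d))
       = ?p * P t k * w - ?N * ?N * (M * (C * ?p * ?d))"
    proof -
      have "(\<Sum>j\<in>UNIV. if i = best then if j = k then ?p * P t k * w else 0 else 0)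
          = (if i = best then ?p * P t k * w else 0)" for i by simp
      thus ?thesis by (simp add: sum_subtractf)
    qed
    moreover have "?p * w * (1/2) \<le> ?p * w * P t k"
      using elim(2) p w by (intro mult_left_mono) (auto simp: e_def)
    moreover have "?N * ?N * (M * (C * ?p * ?d)) \<le> ?p * w * (1/4)"
    proof -
      have "?d * (4 * ?N * ?N * M * C) \<le> w"
        using elim(2) N M \<open>0 < C\<close> by (simp add: e_def pos_less_divide_eq)
      from mult_left_mono[OF this p] show ?thesis by (simp add: algebra_simps)
    qed
    ultimately have "?p * w * (1/4) \<le> (\<Sum>i\<in>UNIV. \<Sum>j\<in>UNIV. P t i * P t j * pair_weight i j a)"
      by (simp add: algebra_simps)
    hence "\<eta> * (?p * w * (1/4)) \<le> 2 * (log_ratio a (Suc t) - log_ratio a t)"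
      unfolding log_ratio_step using eta_pos by (intro mult_left_mono) auto
    thus ?case by (simp add: algebra_simps)
  qed
  thus ?thesis using eta_pos w by (intro exI[of _ "\<eta> * w / 8"]) auto
qed

lemma eventually_uniform_bound:
  assumes "\<And>b. b \<in> S \<Longrightarrow> \<exists>C. \<forall>\<^sub>F t in sequentially. P t b \<le> C * P t best"
  shows "\<exists>C>0. \<forall>\<^sub>F t in sequentially. \<forall>b\<in>S. P t b \<le> C * P t best"
proof -
  obtain C where C: "\<And>b. b \<in> S \<Longrightarrow> \<forall>\<^sub>F t in sequentially. P t b \<le> C b * P t best"
    using assms by metis
  \<comment> \<open>Inserting 1 makes the constant positive and covers the empty \<open>S\<close>
    that arises for the worst action.\<close>
  define D where "D = Max (insert 1 (C ` S))"
  have D: "1 \<le> D" "\<And>b. b \<in> S \<Longrightarrow> C b \<le> D" by (auto simp: D_def)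
  have "\<forall>\<^sub>F t in sequentially. P t b \<le> D * P t best" if "b \<in> S" for b
    using C[OF that]
  proof eventually_elim
    case (elim t)
    have "C b * P t best \<le> D * P t best"
      using D(2)[OF that] P_pos[of t best] by (intro mult_right_mono) auto
    thus ?case using elim by simp
  qed
  hence "\<forall>\<^sub>F t in sequentially. \<forall>b\<in>S. P t b \<le> D * P t best"
    by (intro eventually_ball_finite) auto
  thus ?thesis using D(1) by (intro exI[of _ D]) auto
qed

lemma bound_of_growth:
  assumes "c > 0" "\<forall>\<^sub>F t in sequentially. c * P t best \<le> log_ratio a (Suc t) - log_ratio a t"
  shows "\<exists>C. \<forall>\<^sub>F t in sequentially. P t a \<le> C * P t best"
proof -
  have "\<forall>\<^sub>F t in sequentially. log_ratio a t \<le> log_ratio a (Suc t)"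
    using assms(2)
  proof eventually_elim
    case (elim t)
    have "0 \<le> c * P t best" using assms(1) P_pos[of t best] by simp
    thus ?case using elim by linarith
  qed
  then obtain B where "\<forall>\<^sub>F t in sequentially. B \<le> log_ratio a t"
    using eventually_mono_bounded_below by blast
  hence "\<forall>\<^sub>F t in sequentially. P t a \<le> exp (- B) * P t best"
  proof eventually_elim
    case (elim t)
    thus ?case unfolding P_log_ratio[of t a] using P_pos[of t best] by (intro mult_right_mono) auto
  qed
  thus ?thesis by blast
qed

text \<open>Induction on the number of actions worse than \<open>a\<close>: their bounds make
  \<open>log_ratio a\<close> grow, and this growth bounds \<open>P t a\<close>. For the worst action
  \<open>{a<..}\<close> is empty, so no separate base case arises.\<close>

lemma worse_bounded:
  assumes "k < a" shows "\<exists>C. \<forall>\<^sub>F t in sequentially. P t a \<le> C * P t best"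
  using assms
proof (induction "card {a<..}" arbitrary: a rule: less_induct)
  case less
  have "\<exists>C. \<forall>\<^sub>F t in sequentially. P t b \<le> C * P t best" if "b \<in> {a<..}" for b
  proof (rule less.hyps)
    show "card {b<..} < card {a<..}" using that by (intro psubset_card_mono) auto
    show "k < b" using that less.prems by auto
  qed
  then obtain C where "C > 0" "\<forall>\<^sub>F t in sequentially. \<forall>b\<in>{a<..}. P t b \<le> C * P t best"
    using eventually_uniform_bound[of "{a<..}"] by blast
  then obtain c where "c > 0" "\<forall>\<^sub>F t in sequentially. c * P t best \<le> log_ratio a (Suc t) - log_ratio a t"
    using log_ratio_growth_step[OF less.prems, of C] by auto
  thus ?case by (rule bound_of_growth)
qed

lemma worse_uniformly_bounded:
  "\<exists>C>0. \<forall>\<^sub>F t in sequentially. \<forall>b\<in>{k<..}. P t b \<le> C * P t best"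
  using eventually_uniform_bound[of "{k<..}"] worse_bounded by auto

lemma worse_growth:
  assumes "k < a"
  shows "\<exists>c>0. \<forall>\<^sub>F t in sequentially. c * P t best \<le> log_ratio a (Suc t) - log_ratio a t"
proof -
  obtain C where C: "C > 0" "\<forall>\<^sub>F t in sequentially. \<forall>b\<in>{k<..}. P t b \<le> C * P t best"
    using worse_uniformly_bounded by blast
  have "\<forall>\<^sub>F t in sequentially. \<forall>b\<in>{a<..}. P t b \<le> C * P t best"
    using C(2) by eventually_elim (use assms in auto)
  thus ?thesis using log_ratio_growth_step[OF assms C(1)] by blast
qed

text \<open>As \<open>P t k\<close> tends to 1, \<open>P t best\<close> and with it
  \<open>P t best / P t k\<close> tend to 0.\<close>

lemma log_ratio_k_diverges: "\<forall>\<^sub>F t in sequentially. log_ratio k t \<le> B"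
proof -
  define e where "e = min (1/2) (exp B / 2)"
  have "e > 0" by (simp add: e_def)
  from eventually_compl_less[OF this] show ?thesis
  proof eventually_elim
    case (elim t)
    have "P t best < e" using P_le_compl[OF less_imp_neq[OF best_k], of t] elim by simp
    hence "P t best < exp B * (1/2)" by (simp add: e_def)
    also have "\<dots> \<le> exp B * P t k" using elim by (intro mult_left_mono) (auto simp: e_def)
    finally have "exp (log_ratio k t) * P t k < exp B * P t k" by (simp add: P_best_log_ratio[of t k])
    hence "exp (log_ratio k t) < exp B" using P_pos[of t k] by simp
    thus ?case by simp
  qed
qed

text \<open>Equal pairs have weight 0, and of two distinct actions one differs from
  \<open>k\<close>, so their product is at most \<open>1 - P t k\<close>.\<close>

lemma log_ratio_k_step_bound:
  "\<exists>M>0. \<forall>t. - M * (1 - P t k) \<le> log_ratio k (Suc t) - log_ratio k t"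
proof -
  let ?N = "real CARD('k)"
  obtain M where M: "M > 0" "\<And>i j a. \<bar>pair_weight i j a\<bar> \<le> M" using pair_weight_bound by blast
  have "- (\<eta> * ?N * ?N * M) * (1 - P t k) \<le> log_ratio k (Suc t) - log_ratio k t" for t
  proof -
    have d: "0 \<le> 1 - P t k" using P_le_1[of t k] by simp
    have "- (M * (1 - P t k)) \<le> P t i * P t j * pair_weight i j k" for i j
    proof (cases "i = j")
      case False
      have "P t i * P t j \<le> 1 - P t k"
      proof (cases "i = k")
        case True
        thus ?thesis using False P_le_compl[of j k t] P_le_1[of t i] P_pos[of t i] P_pos[of t j]
          by (intro order_trans[OF mult_left_le_one_le]) auto
      next
        case False
        thus ?thesis using P_le_compl[of i k t] P_le_1[of t j] P_pos[of t i] P_pos[of t j]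
          by (intro order_trans[OF mult_right_le_one_le]) auto
      qed
      hence "P t i * P t j * M \<le> (1 - P t k) * M" using M(1) by (intro mult_right_mono) auto
      moreover have "P t i * P t j * (- M) \<le> P t i * P t j * pair_weight i j k"
        using M(2)[of i j k] by (intro mult_left_mono) (auto simp: abs_le_iff P_pos less_imp_le)
      ultimately show ?thesis by (simp add: algebra_simps)
    qed (use d M(1) in simp)
    hence "(\<Sum>i\<in>(UNIV::'k set). \<Sum>j\<in>(UNIV::'k set). - (M * (1 - P t k)))
        \<le> (\<Sum>i\<in>UNIV. \<Sum>j\<in>UNIV. P t i * P t j * pair_weight i j k)" by (intro sum_mono)
    hence "\<eta> * (- (?N * ?N * (M * (1 - P t k)))) \<le> 2 * (log_ratio k (Suc t) - log_ratio k t)"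
      unfolding log_ratio_step using eta_pos by (intro mult_left_mono) (auto simp: mult.assoc)
    moreover have "0 \<le> \<eta> * ?N * ?N * M * (1 - P t k)" using eta_pos M(1) d by simp
    ultimately show ?thesis by (simp add: algebra_simps)
  qed
  moreover have "\<eta> * ?N * ?N * M > 0" using eta_pos M(1) by simp
  ultimately show ?thesis by blast
qed

lemma value_gap: "value_at t - r $ k = (\<Sum>i\<in>UNIV. P t i * (r $ i - r $ k))"
  by (simp add: value_at_def right_diff_distrib sum_subtractf sum_P flip: sum_distrib_right)

lemma r_diff_bound: "\<bar>r $ i - r $ j\<bar> \<le> 2 * R"
  using r_bound[of i] r_bound[of j] by linarith

text \<open>Relative to \<open>r $ k\<close>, better actions gain at least \<open>\<delta>\<close>
  per unit of probability and worse ones lose at most \<open>2 * R\<close>. As the balance is not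
  positive, the mass of the better actions is controlled by that of the worse ones, hence by
  \<open>P t best\<close>.\<close>

lemma compl_bound:
  assumes value_le_k: "\<And>t. value_at t \<le> r $ k"
  shows "\<exists>C>0. \<forall>\<^sub>F t in sequentially. 1 - P t k \<le> C * P t best"
proof -
  let ?N = "real CARD('k)"
  obtain C where C: "C > 0" "\<forall>\<^sub>F t in sequentially. \<forall>b\<in>{k<..}. P t b \<le> C * P t best"
    using worse_uniformly_bounded by blast
  define \<delta> where "\<delta> = Min ((\<lambda>i. r $ i - r $ k) ` {..<k})"
  have \<delta>: "\<delta> > 0" "\<And>i. i < k \<Longrightarrow> \<delta> \<le> r $ i - r $ k"
  proof -
    have "{..<k} \<noteq> {}" using best_k by blast
    thus "\<delta> > 0" using r_decreasing by (simp add: \<delta>_def)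
  qed (simp add: \<delta>_def)
  have "\<forall>\<^sub>F t in sequentially. 1 - P t k \<le> ?N * ((2 * R + \<delta>) * C) / \<delta> * P t best"
    using C(2)
  proof eventually_elim
    case (elim t)
    let ?s = "(2 * R + \<delta>) * (C * P t best)"
    have s: "0 \<le> ?s" using R_nonneg \<delta>(1) C(1) P_pos[of t best] by simp
    \<comment> \<open>The factor \<open>2 * R + \<delta>\<close> in \<open>?s\<close> pays for a
      worse action's loss and for the \<open>\<delta> * P t i\<close> credited to it on the
      left.\<close>
    have "\<delta> * (P t i - (if i = k then P t k else 0)) - ?s \<le> P t i * (r $ i - r $ k)" for i
    proof (cases i k rule: linorder_cases)
      case less
      have "P t i * \<delta> \<le> P t i * (r $ i - r $ k)"
        using \<delta>(2)[OF less] P_pos[of t i] by (intro mult_left_mono) auto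
      thus ?thesis using less s by (simp add: mult.commute)
    next
      case greater
      have "(2 * R + \<delta>) * P t i \<le> ?s"
        using elim greater R_nonneg \<delta>(1) by (intro mult_left_mono) auto
      moreover have "P t i * (- (2 * R)) \<le> P t i * (r $ i - r $ k)"
        using r_diff_bound[of i k] P_pos[of t i] by (intro mult_left_mono) auto
      ultimately show ?thesis using greater by (simp add: algebra_simps)
    qed (use s in simp)
    hence "(\<Sum>i\<in>UNIV. \<delta> * (P t i - (if i = k then P t k else 0)) - ?s) \<le> value_at t - r $ k"
      unfolding value_gap by (intro sum_mono)
    moreover have "(\<Sum>i\<in>UNIV. \<delta> * (P t i - (if i = k then P t k else 0)) - ?s) = \<delta> * (1 - P t k) - ?N * ?s"
    proof -
      have "(\<Sum>i\<in>UNIV. P t i - (if i = k then P t k else 0)) = 1 - P t k"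
        by (simp add: sum_subtractf sum_P)
      thus ?thesis by (simp add: sum_subtractf flip: sum_distrib_left)
    qed
    ultimately have "\<delta> * (1 - P t k) \<le> ?N * ?s" using value_le_k[of t] by linarith
    thus ?case using \<delta>(1) by (simp add: field_simps)
  qed
  moreover have "?N * ((2 * R + \<delta>) * C) / \<delta> > 0" using R_nonneg \<delta>(1) C(1) by (simp add: add_nonneg_pos)
  ultimately show ?thesis by blast
qed

lemma worse_log_ratio_diverges:
  assumes value_le_k: "\<And>t. value_at t \<le> r $ k" and a: "k < a"
  shows "\<forall>\<^sub>F t in sequentially. B \<le> log_ratio a t"
proof -
  obtain c where c: "c > 0" "\<forall>\<^sub>F t in sequentially. c * P t best \<le> log_ratio a (Suc t) - log_ratio a t"
    using worse_growth[OF a] by blast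
  obtain C where C: "C > 0" "\<forall>\<^sub>F t in sequentially. 1 - P t k \<le> C * P t best"
    using compl_bound[OF value_le_k] by blast
  obtain M where M: "M > 0" "\<And>t. - M * (1 - P t k) \<le> log_ratio k (Suc t) - log_ratio k t"
    using log_ratio_k_step_bound by blast
  \<comment> \<open>The increments of the log ratio for \<open>k\<close> are of order at most \<open>P t best\<close>, those for \<open>a\<close> at least,
    so the divergence of the former to minus infinity forces the latter to plus infinity.\<close>
  define u where "u t = log_ratio a t + c / (M * C) * log_ratio k t" for t
  have "\<forall>\<^sub>F t in sequentially. u t \<le> u (Suc t)"
    using c(2) C(2)
  proof eventually_elim
    case (elim t)
    have "M * (1 - P t k) \<le> M * (C * P t best)" using elim(2) M(1) by (intro mult_left_mono) auto
    hence "- (M * (C * P t best)) \<le> log_ratio k (Suc t) - log_ratio k t" using M(2)[of t] by linarith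
    hence "c / (M * C) * (- (M * (C * P t best))) \<le> c / (M * C) * (log_ratio k (Suc t) - log_ratio k t)"
      using c(1) C(1) M(1) by (intro mult_left_mono) auto
    moreover have "c / (M * C) * (- (M * (C * P t best))) = - (c * P t best)"
      using C(1) M(1) by simp
    ultimately show ?case using elim(1) by (simp add: u_def algebra_simps)
  qed
  then obtain B' where B': "\<forall>\<^sub>F t in sequentially. B' \<le> u t" using eventually_mono_bounded_below by blast
  have q: "c / (M * C) > 0" using c(1) C(1) M(1) by simp
  \<comment> \<open>The threshold is chosen so that the multiple of \<open>log_ratio k t\<close> in
    \<open>u t\<close> is at most \<open>B' - B\<close>.\<close>
  show ?thesis using B' log_ratio_k_diverges[of "(B' - B) / (c / (M * C))"]
  proof eventually_elim
    case (elim t)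
    have "c / (M * C) * log_ratio k t \<le> B' - B"
      using elim(2) unfolding pos_le_divide_eq[OF q] by (simp add: mult.commute)
    thus ?case using elim(1) by (simp add: u_def)
  qed
qed

text \<open>At one late time the gain \<open>P t best * g\<close> of \<open>best\<close> over
  \<open>r $ k\<close> exceeds the total loss through actions worse than \<open>k\<close>, so the
  expected reward exceeds \<open>r $ k\<close>.\<close>

lemma suboptimal_limit_impossible:
  assumes value_le_k: "\<And>t. value_at t \<le> r $ k" shows False
proof -
  let ?N = "real CARD('k)"
  define g where "g = r $ best - r $ k"
  have g: "g > 0" using r_decreasing[OF best_k] by (simp add: g_def)
  \<comment> \<open>Chosen so that the total loss is at most half the gain; \<open>+ 1\<close> keeps
    the denominator positive given just \<open>0 \<le> R\<close>.\<close>
  define e where "e = g / (2 * ?N * (2 * R + 1))"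
  have e: "e > 0" using g R_nonneg by (simp add: e_def)
  have "\<forall>\<^sub>F t in sequentially. \<forall>a\<in>{k<..}. P t a \<le> e * P t best"
  proof (intro eventually_ball_finite ballI)
    fix a assume "a \<in> {k<..}"
    hence "\<forall>\<^sub>F t in sequentially. - ln e \<le> log_ratio a t"
      by (intro worse_log_ratio_diverges[OF value_le_k]) simp
    thus "\<forall>\<^sub>F t in sequentially. P t a \<le> e * P t best"
    proof eventually_elim
      case (elim t)
      hence "exp (- log_ratio a t) \<le> exp (ln e)" by simp
      thus ?case unfolding P_log_ratio[of t a] using e P_pos[of t best] by (intro mult_right_mono) auto
    qed
  qed simp
  then obtain t where t: "\<And>a. k < a \<Longrightarrow> P t a \<le> e * P t best"
    unfolding eventually_sequentially by auto
  let ?s = "2 * R * (e * P t best)"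
  have s: "0 \<le> ?s" using R_nonneg e P_pos[of t best] by simp
  have "(if i = best then P t best * g else 0) - ?s \<le> P t i * (r $ i - r $ k)" for i
  proof (cases "k < i")
    case True
    have "2 * R * P t i \<le> ?s" using t[OF True] R_nonneg by (intro mult_left_mono) auto
    moreover have "P t i * (- (2 * R)) \<le> P t i * (r $ i - r $ k)"
      using r_diff_bound[of i k] P_pos[of t i] by (intro mult_left_mono) auto
    moreover have "i \<noteq> best" using True best_k by auto
    ultimately show ?thesis by (simp add: algebra_simps)
  next
    case False
    hence "0 \<le> P t i * (r $ i - r $ k)"
      using r_decreasing[of i k] P_pos[of t i] by (cases i k rule: linorder_cases) auto
    thus ?thesis using s by (auto simp: g_def)
  qed
  hence "(\<Sum>i\<in>UNIV. (if i = best then P t best * g else 0) - ?s) \<le> value_at t - r $ k"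
    unfolding value_gap by (intro sum_mono)
  moreover have "(\<Sum>i\<in>UNIV. (if i = best then P t best * g else 0) - ?s) = P t best * g - ?N * ?s"
    by (simp add: sum_subtractf)
  moreover have "?N * ?s < P t best * g"
  proof -
    have "2 * ?N * (2 * R + 1) * e = g" using R_nonneg by (simp add: e_def)
    moreover have "0 \<le> ?N * e" using e by simp
    ultimately have "?N * (2 * R * e) \<le> g / 2" by (simp add: algebra_simps)
    also have "\<dots> < g" using g by simp
    finally have "?N * (2 * R * e) * P t best < g * P t best" using P_pos[of t best] by simp
    thus ?thesis by (simp add: algebra_simps)
  qed
  ultimately show False using value_le_k[of t] by linarith
qed

end

theorem P_best_tendsto_1: "(\<lambda>t. P t best) \<longlonglongrightarrow> 1"
proof -
  obtain k where k: "(\<lambda>t. P t k) \<longlonglongrightarrow> 1" "\<And>t. value_at t \<le> r $ k"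
    using P_concentrates by metis
  hence "\<not> best < k" using suboptimal_limit_impossible by blast
  hence "k = best" using best_le[of k] by simp
  thus ?thesis using k(1) by simp
qed

end

section \<open>Transfer to the matrix formulation\<close>

theorem theorem6:
  fixes X :: "real^'d^('k::{finite,linorder})"
    and r :: "real^('k::{finite,linorder})"
    and R_max \<eta> :: real
    and a_star :: "'k::{finite,linorder}"
    and \<theta> :: "nat \<Rightarrow> real^'d"
  assumes R_max_pos: "R_max > 0"
    and r_range: "\<forall>a. r $ a \<in> {- R_max..R_max}"
    and r_decreasing: "\<forall>i j. i < j \<longrightarrow> r $ i > r $ j"
    and a_star_first: "a_star = Min UNIV"
    and dim_le: "CARD('d) \<le> CARD('k)"
    and ordering_preserved:
      "\<exists>w. \<forall>i j. (X *v w) $ i > (X *v w) $ j \<longleftrightarrow> r $ i > r $ j"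
    and feature_condition:
      "\<forall>i j k. r $ i > r $ j \<and> r $ i > r $ k \<longrightarrow>
         (if i = a_star \<or> j = k
          then (row i X - row j X) \<bullet> (row a_star X - row k X) > 0
          else (row i X - row j X) \<bullet> (row a_star X - row k X) \<ge> 0)"
    and step_size: "0 < \<eta>" "\<eta> < 4 / (9 * R_max * lambda_max (transpose X ** X))"
    and update: "\<forall>t\<ge>1. \<theta> (Suc t) = pg_step X r \<eta> (\<theta> t)"
  shows "(\<lambda>t. policy X (\<theta> t) $ a_star) \<longlonglongrightarrow> 1"
proof -
  \<comment> \<open>Otherwise the upper bound on \<open>\<eta>\<close> would be at most 0, also in
    the case of division by zero.\<close>
  have lam: "0 < lambda_max (transpose X ** X)"
  proof (rule ccontr)
    assume "\<not> ?thesis"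
    hence "9 * R_max * lambda_max (transpose X ** X) \<le> 0"
      using R_max_pos by (simp add: mult_nonneg_nonpos)
    hence "4 / (9 * R_max * lambda_max (transpose X ** X)) \<le> 0" by (simp add: divide_nonneg_nonpos)
    thus False using step_size by linarith
  qed
  have row: "row i X = X $ i" for i by (simp add: row_def vec_lambda_eta)
  have less: "r $ i > r $ j \<longleftrightarrow> i < j" for i j
    using r_decreasing by (metis less_asym linorder_neqE)
  \<comment> \<open>The update holds from index 1 on, so the sequence is shifted to start at
    \<open>\<theta> 1\<close>; \<open>LIMSEQ_imp_Suc\<close> undoes the shift.\<close>
  interpret softmax_policy_gradient X r R_max \<eta> a_star "\<lambda>t. \<theta> (Suc t)"
  proof
    show "\<bar>r $ a\<bar> \<le> R_max" for a
    proof -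
      have "r $ a \<in> {- R_max..R_max}" using r_range by blast
      thus ?thesis by auto
    qed
    show "i < j \<Longrightarrow> r $ j < r $ i" for i j using less by simp
    show "a_star \<le> a" for a by (simp add: a_star_first)
    show "\<exists>w. \<forall>i j. i < j \<longrightarrow> X $ j \<bullet> w < X $ i \<bullet> w"
      using ordering_preserved by (auto simp: less matrix_vector_mul_component)
    show "0 < (X $ a_star - X $ j) \<bullet> (X $ a_star - X $ k)" if "a_star < j" "a_star < k" for j k
      using feature_condition[rule_format, of j a_star k] that by (simp add: less row)
    show "0 \<le> (X $ i - X $ j) \<bullet> (X $ a_star - X $ k)" if "i < j" "i < k" for i j k
      using feature_condition[rule_format, of j i k] that
      by (auto simp: less row less_imp_le split: if_splits)
    show "0 < \<eta>" by (rule step_size)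
    show "\<eta> * R_max * lambda_max (transpose X ** X) < 1"
      using step_size(2) R_max_pos lam by (simp add: field_simps)
    show "\<theta> (Suc (Suc t)) = pg_step X r \<eta> (\<theta> (Suc t))" for t using update by simp
  qed
  show ?thesis
    by (rule LIMSEQ_imp_Suc) (use P_best_tendsto_1 in \<open>simp add: P_def\<close>)
qed

end
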